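(* Let $I$ be an instance of the 0--1 Multiple Knapsack Problem (MKP) with optimal solution value $z_{MKP}$. Let $I_s$ be any sequential relaxation of $I$, and let $z_{seq}$ be the optimal solution value of $I_s$ (as an instance of the Bounded Sequential Multiple Knapsack Problem). Then $z_{seq}$ is an upper bound for $z_{MKP}$, i.e. $$z_{MKP}\le z_{seq}.$$
   Context: **MKP.** An instance $I$ of MKP consists of $n$ items with weights $w_1,\dots,w_n$ (positive integers) and profits $p_1,\dots,p_n$ (positive real numbers), and $m$ knapsacks with capacities $c_1,\dots,c_m$ (positive integers). Its optimal solution value is $$z_{MKP}=\max \sum_{i=1}^{m}\sum_{j=1}^{n} p_jx_{ij}$$ subject to $\sum_{j=1}^{n}w_jx_{ij}\le c_i$ for $i=1,\dots,m$; $\sum_{i=1}^{m}x_{ij}\le 1$ for $j=1,\dots,n$; $x_{ij}\in\{0,1\}$ for all $i,j$. **BSMKP.** An instance of the Bounded Sequential Multiple Knapsack Problem (BSMKP) consists of items partitioned into $\bar n$ classes and $\bar m$ knapsacks with positive integer capacities $\bar c_1,\dots,\bar c_{\bar m}$. Each item of class $t$ has a positive integer size $s_t$ and a positive real profit $v_t$, and there are $b_t$ items of class $t$ ($b_t$ a positive integer), for $t=1,\dots,\bar n$. The sizes are divisible: $s_{t+1}$ is divisible by $s_t$ for $t=1,\dots,\bar n-1$. The optimal solution value is $$\max \sum_{i=1}^{\bar m}\sum_{t=1}^{\bar n}v_ty_{it}$$ subject to $\sum_{t=1}^{\bar n}s_ty_{it}\le \bar c_i$ for $i=1,\dots,\bar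 m$; $\sum_{i=1}^{\bar m}y_{it}\le b_t$ for $t=1,\dots,\bar n$; $y_{it}$ nonnegative integers. **Sequential relaxation.** A sequential relaxation of an MKP instance $I$ is an instance $I_s$ of BSMKP obtained by replacing each item $j$ of $I$ with a finite set of items $S_j=\{j_1,\dots,j_{K_j}\}$ with positive integer sizes $s_{j_1}\le s_{j_2}\le\dots\le s_{j_{K_j}}$ and profits $v_{j_1},\dots,v_{j_{K_j}}$ such that: 1. $\sum_{k=1}^{K_j}s_{j_k}=w_j$ for $j=1,\dots,n$; 2. $v_{j_k}=\frac{p_j}{w_j}s_{j_k}$ for $j=1,\dots,n$ and $k=1,\dots,K_j$; 3. the sizes $s_{j_k}$, over all $j=1,\dots,n$ and $k=1,\dots,K_j$, are divisible, i.e. when all of them are listed in nondecreasing order, each is divisible by the preceding one. All items of $I_s$ with the same size and the same profit belong to the same class (so $b_t$ is the total number of generated items having the size $s_t$ and profit $v_t$ of class $t$). The knapsacks of $I_s$ are those of $I$: $\bar m=m$ and $\bar c_i=c_i$ for $i=1,\dots,m$. There may be many sequential relaxations of the same instance $I$, depending on the choice of the sizes $s_{j_k}$. *)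

theory Defs
  imports Complex_Main
begin

text \<open>
  Items, item classes and knapsacks are numbered from 1; the values of the component functions
  outside the respective index ranges are irrelevant.
\<close>

record mkp =
  n_items :: nat
  weight :: "nat \<Rightarrow> nat"
  profit :: "nat \<Rightarrow> real"
  n_knaps :: nat
  cap :: "nat \<Rightarrow> nat"

definition mkp_instance :: "mkp \<Rightarrow> bool" where
  "mkp_instance I \<longleftrightarrow>
     (\<forall>j\<in>{1..n_items I}. weight I j > 0 \<and> profit I j > 0) \<and>
     (\<forall>i\<in>{1..n_knaps I}. cap I i > 0)"

definition mkp_feasible :: "mkp \<Rightarrow> (nat \<Rightarrow> nat \<Rightarrow> nat) \<Rightarrow> bool" where
  "mkp_feasible I x \<longleftrightarrow>
     (\<forall>i\<in>{1..n_knaps I}. (\<Sum>j=1..n_items I. weight I j * x i j) \<le> cap I i) \<and>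
     (\<forall>j\<in>{1..n_items I}. (\<Sum>i=1..n_knaps I. x i j) \<le> 1) \<and>
     (\<forall>i\<in>{1..n_knaps I}. \<forall>j\<in>{1..n_items I}. x i j \<in> {0, 1})"

definition mkp_value :: "mkp \<Rightarrow> (nat \<Rightarrow> nat \<Rightarrow> nat) \<Rightarrow> real" where
  "mkp_value I x = (\<Sum>i=1..n_knaps I. \<Sum>j=1..n_items I. profit I j * real (x i j))"

definition z_MKP :: "mkp \<Rightarrow> real" where
  "z_MKP I = Max {mkp_value I x | x. mkp_feasible I x}"

record bsmkp =
  n_classes :: nat
  class_size :: "nat \<Rightarrow> nat"
  class_profit :: "nat \<Rightarrow> real"
  class_bound :: "nat \<Rightarrow> nat"
  bs_n_knaps :: nat
  bs_cap :: "nat \<Rightarrow> nat"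

definition bsmkp_instance :: "bsmkp \<Rightarrow> bool" where
  "bsmkp_instance B \<longleftrightarrow>
     (\<forall>t\<in>{1..n_classes B}. class_size B t > 0 \<and> class_profit B t > 0 \<and> class_bound B t > 0) \<and>
     (\<forall>t\<in>{1..<n_classes B}. class_size B t dvd class_size B (t + 1)) \<and>
     (\<forall>i\<in>{1..bs_n_knaps B}. bs_cap B i > 0)"

definition bsmkp_feasible :: "bsmkp \<Rightarrow> (nat \<Rightarrow> nat \<Rightarrow> nat) \<Rightarrow> bool" where
  "bsmkp_feasible B y \<longleftrightarrow>
     (\<forall>i\<in>{1..bs_n_knaps B}. (\<Sum>t=1..n_classes B. class_size B t * y i t) \<le> bs_cap B i) \<and>
     (\<forall>t\<in>{1..n_classes B}. (\<Sum>i=1..bs_n_knaps B. y i t) \<le> class_bound B t)"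

definition bsmkp_value :: "bsmkp \<Rightarrow> (nat \<Rightarrow> nat \<Rightarrow> nat) \<Rightarrow> real" where
  "bsmkp_value B y = (\<Sum>i=1..bs_n_knaps B. \<Sum>t=1..n_classes B. class_profit B t * real (y i t))"

definition z_BSMKP :: "bsmkp \<Rightarrow> real" where
  "z_BSMKP B = Max {bsmkp_value B y | y. bsmkp_feasible B y}"

text \<open>
  Item \<open>j\<close> is split into the items \<open>(j, 1), \<dots>, (j, K j)\<close>; \<open>(j, k)\<close> has size \<open>s j k\<close> and
  profit \<open>v j k\<close>.
\<close>

definition split_sizes :: "nat \<Rightarrow> (nat \<Rightarrow> nat) \<Rightarrow> (nat \<Rightarrow> nat \<Rightarrow> nat) \<Rightarrow> nat list" where
  "split_sizes n K s = concat (map (\<lambda>j. map (s j) [1..<Suc (K j)]) [1..<Suc n])"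

definition item_splitting ::
  "mkp \<Rightarrow> (nat \<Rightarrow> nat) \<Rightarrow> (nat \<Rightarrow> nat \<Rightarrow> nat) \<Rightarrow> (nat \<Rightarrow> nat \<Rightarrow> real) \<Rightarrow> bool" where
  "item_splitting I K s v \<longleftrightarrow>
     (\<forall>j\<in>{1..n_items I}.
        (\<forall>k\<in>{1..K j}. s j k > 0) \<and>
        (\<forall>k\<in>{1..<K j}. s j k \<le> s j (k + 1)) \<and>
        (\<Sum>k=1..K j. s j k) = weight I j \<and>
        (\<forall>k\<in>{1..K j}. v j k = profit I j / real (weight I j) * real (s j k))) \<and>
     successively (dvd) (sort (split_sizes (n_items I) K s))"

text \<open>
  The classes of \<open>B\<close> are the groups of generated items sharing both size and profit: distinct
  classes have distinct (size, profit) pairs, every generated item falls into a class, and each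
  bound counts the items of its class. Conversely, no class is empty since the bounds of
  \<open>B\<close> are positive.
\<close>

definition sequential_relaxation :: "mkp \<Rightarrow> bsmkp \<Rightarrow> bool" where
  "sequential_relaxation I B \<longleftrightarrow>
     bsmkp_instance B \<and>
     bs_n_knaps B = n_knaps I \<and>
     (\<forall>i\<in>{1..n_knaps I}. bs_cap B i = cap I i) \<and>
     (\<exists>K s v. item_splitting I K s v \<and>
        inj_on (\<lambda>t. (class_size B t, class_profit B t)) {1..n_classes B} \<and>
        (\<forall>j\<in>{1..n_items I}. \<forall>k\<in>{1..K j}. \<exists>t\<in>{1..n_classes B}.
           class_size B t = s j k \<and> class_profit B t = v j k) \<and>
        (\<forall>t\<in>{1..n_classes B}. class_bound B t =
           card {(j, k). j \<in> {1..n_items I} \<and> k \<in> {1..K j} \<and>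
                   s j k = class_size B t \<and> v j k = class_profit B t}))"

text \<open>The maxima above are attained: the sets of objective values are finite and nonempty.\<close>

lemma finite_sums_bounded:
  fixes q :: "nat \<Rightarrow> real"
  assumes "finite A" "finite C"
  shows "finite {\<Sum>i\<in>A. \<Sum>j\<in>C. q j * real (x i j) | x. \<forall>i\<in>A. \<forall>j\<in>C. x i j \<le> (N::nat)}"
proof -
  let ?F = "{f. (\<forall>z. (z \<in> A \<times> C \<longrightarrow> f z \<in> {..N}) \<and> (z \<notin> A \<times> C \<longrightarrow> f z = 0))}"
  let ?g = "\<lambda>f. \<Sum>i\<in>A. \<Sum>j\<in>C. q j * real (f (i, j))"
  have fin: "finite ?F"
    using assms by (intro finite_set_of_finite_funs) auto
  have "{\<Sum>i\<in>A. \<Sum>j\<in>C. q j * real (x i j) | x. \<forall>i\<in>A. \<forall>j\<in>C. x i j \<le> N} \<subseteq> ?g ` ?F"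
  proof
    fix r assume "r \<in> {\<Sum>i\<in>A. \<Sum>j\<in>C. q j * real (x i j) | x. \<forall>i\<in>A. \<forall>j\<in>C. x i j \<le> N}"
    then obtain x where r: "r = (\<Sum>i\<in>A. \<Sum>j\<in>C. q j * real (x i j))"
      and x: "\<forall>i\<in>A. \<forall>j\<in>C. x i j \<le> N" by blast
    let ?f = "\<lambda>z. if z \<in> A \<times> C then x (fst z) (snd z) else 0"
    have "?f \<in> ?F" using x by auto
    moreover have "r = ?g ?f" unfolding r by (intro sum.cong) auto
    ultimately show "r \<in> ?g ` ?F" using image_eqI[of r ?g ?f ?F] by blast
  qed
  with fin show ?thesis by (meson finite_imageI finite_subset)
qed

lemma finite_mkp_values: "finite {mkp_value I x | x. mkp_feasible I x}"
proof (rule finite_subset)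
  show "{mkp_value I x | x. mkp_feasible I x} \<subseteq>
    {\<Sum>i\<in>{1..n_knaps I}. \<Sum>j\<in>{1..n_items I}. profit I j * real (x i j) | x.
       \<forall>i\<in>{1..n_knaps I}. \<forall>j\<in>{1..n_items I}. x i j \<le> 1}"
  proof
    fix r assume "r \<in> {mkp_value I x | x. mkp_feasible I x}"
    then obtain x where r: "r = mkp_value I x" and x: "mkp_feasible I x" by blast
    have "x i j \<le> 1" if "i \<in> {1..n_knaps I}" "j \<in> {1..n_items I}" for i j
    proof -
      have "x i j \<in> {0, 1}" using x that unfolding mkp_feasible_def by blast
      then show ?thesis by auto
    qed
    then show "r \<in> {\<Sum>i\<in>{1..n_knaps I}. \<Sum>j\<in>{1..n_items I}. profit I j * real (x i j) | x.
       \<forall>i\<in>{1..n_knaps I}. \<forall>j\<in>{1..n_items I}. x i j \<le> 1}"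
      unfolding r mkp_value_def by blast
  qed
qed (rule finite_sums_bounded; simp)

lemma mkp_values_nonempty: "{mkp_value I x | x. mkp_feasible I x} \<noteq> {}"
proof -
  have "mkp_feasible I (\<lambda>_ _. 0)" by (simp add: mkp_feasible_def)
  then show ?thesis by blast
qed

lemma finite_bsmkp_values: "finite {bsmkp_value B y | y. bsmkp_feasible B y}"
proof (rule finite_subset)
  let ?N = "\<Sum>t=1..n_classes B. class_bound B t"
  show "{bsmkp_value B y | y. bsmkp_feasible B y} \<subseteq>
    {\<Sum>i\<in>{1..bs_n_knaps B}. \<Sum>t\<in>{1..n_classes B}. class_profit B t * real (y i t) | y.
       \<forall>i\<in>{1..bs_n_knaps B}. \<forall>t\<in>{1..n_classes B}. y i t \<le> ?N}"
  proof
    fix r assume "r \<in> {bsmkp_value B y | y. bsmkp_feasible B y}"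
    then obtain y where r: "r = bsmkp_value B y" and y: "bsmkp_feasible B y" by blast
    have "y i t \<le> ?N" if "i \<in> {1..bs_n_knaps B}" "t \<in> {1..n_classes B}" for i t
    proof -
      have "y i t \<le> (\<Sum>i=1..bs_n_knaps B. y i t)" using that by (intro member_le_sum) auto
      also have "\<dots> \<le> class_bound B t" using y that by (auto simp: bsmkp_feasible_def)
      also have "\<dots> \<le> ?N" using that by (intro member_le_sum) auto
      finally show ?thesis .
    qed
    then show "r \<in> {\<Sum>i\<in>{1..bs_n_knaps B}. \<Sum>t\<in>{1..n_classes B}. class_profit B t * real (y i t) | y.
       \<forall>i\<in>{1..bs_n_knaps B}. \<forall>t\<in>{1..n_classes B}. y i t \<le> ?N}"
      unfolding r bsmkp_value_def by blast
  qed
qed (rule finite_sums_bounded; simp)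

lemma bsmkp_values_nonempty: "{bsmkp_value B y | y. bsmkp_feasible B y} \<noteq> {}"
proof -
  have "bsmkp_feasible B (\<lambda>_ _. 0)" by (simp add: bsmkp_feasible_def)
  then show ?thesis by blast
qed

end

theory Submission
  imports Defs
begin

text \<open>
  Pack the pieces of an item into the knapsack that holds the item. The pieces fill exactly the
  space of the item and, having all the same profit per unit of size, are together worth exactly
  its profit.
\<close>

text \<open>Grouping \<open>A\<close> by the value of \<open>g\<close> makes the summand constant on
  each fibre. The inclusion ensures that every fibre is reached, and injectivity of \<open>h\<close>
  that none is counted twice. The semiring is left general because sizes are natural numbers and
  profits are real.\<close>

lemma sum_times_card_fibre:
  fixes f :: "'b \<Rightarrow> 'c::semiring_1"
  assumes "finite A" "finite T" "inj_on h T" "g ` A \<subseteq> h ` T"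
  shows "(\<Sum>t\<in>T. f (h t) * of_nat (card {k\<in>A. g k = h t})) = (\<Sum>k\<in>A. f (g k))"
proof -
  have "(\<Sum>k\<in>A. f (g k)) = (\<Sum>u\<in>h ` T. \<Sum>k\<in>{k\<in>A. g k = u}. f (g k))"
    using assms by (intro sum.group[symmetric]) auto
  also have "\<dots> = (\<Sum>u\<in>h ` T. f u * of_nat (card {k\<in>A. g k = u}))"
    by (intro sum.cong) (simp_all add: mult_of_nat_commute)
  also have "\<dots> = (\<Sum>t\<in>T. f (h t) * of_nat (card {k\<in>A. g k = h t}))"
    using assms(3) by (simp add: sum.reindex)
  finally show ?thesis ..
qed

lemma mkp_feasible_imp_relaxation_feasible:
  assumes I: "mkp_instance I" and rel: "sequential_relaxation I B" and x: "mkp_feasible I x"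
  obtains y where "bsmkp_feasible B y" "bsmkp_value B y = mkp_value I x"
proof -
  obtain K s v where split: "item_splitting I K s v"
    and inj: "inj_on (\<lambda>t. (class_size B t, class_profit B t)) {1..n_classes B}"
    and cover: "\<And>j k. j \<in> {1..n_items I} \<Longrightarrow> k \<in> {1..K j} \<Longrightarrow>
      \<exists>t\<in>{1..n_classes B}. class_size B t = s j k \<and> class_profit B t = v j k"
    and bound: "\<And>t. t \<in> {1..n_classes B} \<Longrightarrow> class_bound B t =
      card {(j, k). j \<in> {1..n_items I} \<and> k \<in> {1..K j} \<and>
        s j k = class_size B t \<and> v j k = class_profit B t}"
    using rel unfolding sequential_relaxation_def by blast
  have knaps: "bs_n_knaps B = n_knaps I" "\<And>i. i \<in> {1..n_knaps I} \<Longrightarrow> bs_cap B i = cap I i"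
    using rel unfolding sequential_relaxation_def by blast+
  \<comment> \<open>\<open>N j t\<close> counts the pieces of item \<open>j\<close> in class
    \<open>t\<close>. The condition is an equation of pairs so that it is a fibre of the map from
    pieces to their (size, profit) pairs.\<close>
  define N where "N j t =
    card {k\<in>{1..K j}. (s j k, v j k) = (class_size B t, class_profit B t)}" for j t
  \<comment> \<open>Knapsack \<open>i\<close> receives all pieces of exactly those items that
    \<open>x\<close> puts there.\<close>
  define y where "y i t = (\<Sum>j=1..n_items I. x i j * N j t)" for i t
  have image: "(\<lambda>k. (s j k, v j k)) ` {1..K j}
      \<subseteq> (\<lambda>t. (class_size B t, class_profit B t)) ` {1..n_classes B}"
    if j: "j \<in> {1..n_items I}" for j
  proof
    fix u assume "u \<in> (\<lambda>k. (s j k, v j k)) ` {1..K j}"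
    then obtain k where "k \<in> {1..K j}" "u = (s j k, v j k)" by blast
    then show "u \<in> (\<lambda>t. (class_size B t, class_profit B t)) ` {1..n_classes B}"
      using cover[OF j, of k] by force
  qed
  have size_eq: "(\<Sum>t=1..n_classes B. class_size B t * N j t) = weight I j"
    if j: "j \<in> {1..n_items I}" for j
  proof -
    have "(\<Sum>t=1..n_classes B. class_size B t * N j t) = (\<Sum>k=1..K j. s j k)"
      using sum_times_card_fibre[OF _ _ inj image[OF j], of fst] by (simp add: N_def)
    with split j show ?thesis unfolding item_splitting_def by metis
  qed
  have profit_eq: "(\<Sum>t=1..n_classes B. class_profit B t * real (N j t)) = profit I j"
    if j: "j \<in> {1..n_items I}" for j
  proof -
    have "(\<Sum>t=1..n_classes B. class_profit B t * real (N j t)) = (\<Sum>k=1..K j. v j k)"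
      using sum_times_card_fibre[OF _ _ inj image[OF j], of snd] by (simp add: N_def)
    also have "\<dots> = (\<Sum>k=1..K j. profit I j / real (weight I j) * real (s j k))"
      using split j unfolding item_splitting_def by (intro sum.cong) auto
    also have "\<dots> = profit I j / real (weight I j) * real (\<Sum>k=1..K j. s j k)"
      by (simp add: sum_distrib_left)
    also have "(\<Sum>k=1..K j. s j k) = weight I j"
      using split j unfolding item_splitting_def by blast
    \<comment> \<open>The cancellation is legitimate because weights in an instance are
      positive.\<close>
    also have "profit I j / real (weight I j) * real (weight I j) = profit I j"
      using I j unfolding mkp_instance_def by force
    finally show ?thesis .
  qed
  have bound_eq: "class_bound B t = (\<Sum>j=1..n_items I. N j t)" if t: "t \<in> {1..n_classes B}" for t
  proof -
    \<comment> \<open>A class may mix pieces of different items; sorting its pieces by their item of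
      origin turns the count into a sum over \<open>j\<close>.\<close>
    have "{(j, k). j \<in> {1..n_items I} \<and> k \<in> {1..K j} \<and>
          s j k = class_size B t \<and> v j k = class_profit B t} =
        Sigma {1..n_items I}
          (\<lambda>j. {k\<in>{1..K j}. (s j k, v j k) = (class_size B t, class_profit B t)})"
      by auto
    then show ?thesis
      unfolding bound[OF t] N_def by simp
  qed
  have "bsmkp_feasible B y"
    unfolding bsmkp_feasible_def
  proof (intro conjI ballI)
    fix i assume "i \<in> {1..bs_n_knaps B}"
    then have i: "i \<in> {1..n_knaps I}" by (simp add: knaps)
    \<comment> \<open>Swapping the sums measures the load item by item instead of class by class, so
      \<open>size_eq\<close> reduces it to the load under \<open>x\<close>.\<close>
    have "(\<Sum>t=1..n_classes B. class_size B t * y i t) =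
        (\<Sum>t=1..n_classes B. \<Sum>j=1..n_items I. x i j * (class_size B t * N j t))"
      by (simp add: y_def sum_distrib_left mult_ac)
    also have "\<dots> = (\<Sum>j=1..n_items I. x i j * (\<Sum>t=1..n_classes B. class_size B t * N j t))"
      by (subst sum.swap) (simp add: sum_distrib_left)
    also have "\<dots> = (\<Sum>j=1..n_items I. weight I j * x i j)"
      using size_eq by (intro sum.cong) auto
    also have "\<dots> \<le> bs_cap B i"
      using x i by (simp add: mkp_feasible_def knaps)
    finally show "(\<Sum>t=1..n_classes B. class_size B t * y i t) \<le> bs_cap B i" .
  next
    fix t assume t: "t \<in> {1..n_classes B}"
    \<comment> \<open>The inner sum is the number of knapsacks holding item \<open>j\<close>. It is
      at most 1, so no piece is used twice.\<close>
    have "(\<Sum>i=1..bs_n_knaps B. y i t) = (\<Sum>j=1..n_items I. (\<Sum>i=1..n_knaps I. x i j) * N j t)"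
      unfolding y_def knaps by (subst sum.swap) (simp add: sum_distrib_right)
    also have "\<dots> \<le> (\<Sum>j=1..n_items I. 1 * N j t)"
      using x unfolding mkp_feasible_def by (intro sum_mono mult_right_mono) auto
    finally show "(\<Sum>i=1..bs_n_knaps B. y i t) \<le> class_bound B t"
      by (simp add: bound_eq[OF t])
  qed
  moreover have "bsmkp_value B y = mkp_value I x"
    unfolding bsmkp_value_def mkp_value_def knaps
  proof (rule sum.cong[OF refl])
    fix i
    have "(\<Sum>t=1..n_classes B. class_profit B t * real (y i t)) =
        (\<Sum>t=1..n_classes B. \<Sum>j=1..n_items I. real (x i j) * (class_profit B t * real (N j t)))"
      by (simp add: y_def sum_distrib_left mult_ac)
    also have "\<dots> = (\<Sum>j=1..n_items I. real (x i j) *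
        (\<Sum>t=1..n_classes B. class_profit B t * real (N j t)))"
      by (subst sum.swap) (simp add: sum_distrib_left)
    also have "\<dots> = (\<Sum>j=1..n_items I. profit I j * real (x i j))"
      using profit_eq by (intro sum.cong) auto
    finally show "(\<Sum>t=1..n_classes B. class_profit B t * real (y i t)) =
        (\<Sum>j=1..n_items I. profit I j * real (x i j))" .
  qed
  ultimately show ?thesis by (rule that)
qed

theorem lemma2:
  fixes I :: mkp and I\<^sub>s :: bsmkp
  assumes "mkp_instance I"
    and "sequential_relaxation I I\<^sub>s"
  shows "z_MKP I \<le> z_BSMKP I\<^sub>s"
  unfolding z_MKP_def z_BSMKP_def
\<comment> \<open>Since the packing of pieces preserves the value exactly, every value attained in
  \<open>I\<close> is attained in the relaxation, and the maxima compare by inclusion.\<close>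
proof (rule Max_mono)
  show "{mkp_value I x | x. mkp_feasible I x} \<subseteq> {bsmkp_value I\<^sub>s y | y. bsmkp_feasible I\<^sub>s y}"
  proof clarify
    fix x assume "mkp_feasible I x"
    from mkp_feasible_imp_relaxation_feasible[OF assms this]
    show "\<exists>y. mkp_value I x = bsmkp_value I\<^sub>s y \<and> bsmkp_feasible I\<^sub>s y"
      by metis
  qed
qed (rule mkp_values_nonempty finite_bsmkp_values)+

end
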